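(* Let $\pi$ be a unitary representation of a group $G$ in a Hilbert space $\mathcal H$. If the dynamical system $(\mathbb S_{\mathcal H},G,\pi)$ has the concentration property, then the representation $\pi$ is amenable.
   Context: As usual for unitary representations, Hilbert spaces are complex. $G$ is an abstract group; no topology on $G$ and no continuity of $\pi$ is assumed. $\mathbb S_{\mathcal H}$ is the unit sphere of $\mathcal H$, with the uniform structure given by the norm distance, on which $G$ acts by the operators $\pi(g)$. Amenable representation (Bekka): $\pi$ is amenable if there is a linear functional $\phi\in\mathcal L(\mathcal H)^*$ on the algebra $\mathcal L(\mathcal H)$ of all bounded operators with $\phi\ge 0$, $\phi(\mathbb I)=1$ and $\phi(\pi(g)T\pi(g)^{-1})=\phi(T)$ for all $T\in\mathcal L(\mathcal H)$, $g\in G$. Concentration property: a set $A\subseteq\mathbb S_{\mathcal H}$ is essential if for every $\epsilon>0$ and every finite collection $g_1,\dots,g_n\in G$ one has $\bigcap_{i=1}^n\pi(g_i)\mathcal O_\epsilon(A)\ne\emptyset$, where $\mathcal O_\epsilon(A)$ is the $\epsilon$-neighbourhood of $A$ in $\mathbb S_{\mathcal H}$. The system $(\mathbb S_{\mathcal H},G,\pi)$ has the concentration property if every finite cover of $\mathbb S_{\mathcal H}$ by subsets contains an essential set. *)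

theory Defs
  imports "HOL-Analysis.Analysis" "HOL-Algebra.Group"
begin

text \<open>
  Complex Hilbert spaces. The underlying real Banach space supplies the norm, the metric and
  completeness; the last axiom says that this norm is the one induced by the inner product,
  which is linear in the first argument.
\<close>

class chilbert_space = banach +
  fixes scaleC :: "complex \<Rightarrow> 'a \<Rightarrow> 'a"  (infixr "*\<^sub>C" 75)
    and cinner :: "'a \<Rightarrow> 'a \<Rightarrow> complex"
  assumes scaleC_add_right: "c *\<^sub>C (x + y) = c *\<^sub>C x + c *\<^sub>C y"
    and scaleC_add_left: "(c + d) *\<^sub>C x = c *\<^sub>C x + d *\<^sub>C x"
    and scaleC_scaleC: "c *\<^sub>C d *\<^sub>C x = (c * d) *\<^sub>C x"
    and scaleC_of_real: "complex_of_real r *\<^sub>C x = r *\<^sub>R x"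
    and cinner_commute: "cinner x y = cnj (cinner y x)"
    and cinner_add_left: "cinner (x + y) z = cinner x z + cinner y z"
    and cinner_scaleC_left: "cinner (c *\<^sub>C x) y = c * cinner x y"
    and cinner_self: "cinner x x = complex_of_real ((norm x)\<^sup>2)"

instantiation complex :: chilbert_space
begin

definition scaleC_complex :: "complex \<Rightarrow> complex \<Rightarrow> complex"
  where "scaleC_complex c x = c * x"

definition cinner_complex :: "complex \<Rightarrow> complex \<Rightarrow> complex"
  where "cinner_complex x y = x * cnj y"

instance
proof
  fix x :: complex
  show "cinner x x = complex_of_real ((norm x)\<^sup>2)"
    unfolding cinner_complex_def by (rule complex_norm_square [symmetric])
qed (simp_all add: scaleC_complex_def cinner_complex_def algebra_simps scaleR_conv_of_real)

end

lemma vector_space_scaleC: "vector_space (scaleC :: complex \<Rightarrow> 'h \<Rightarrow> 'h::chilbert_space)"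
proof
  show "1 *\<^sub>C x = x" for x :: 'h
    using scaleC_of_real [of 1 x] by simp
qed (simp_all add: scaleC_add_right scaleC_add_left scaleC_scaleC)

definition bounded_operators :: "('h::chilbert_space \<Rightarrow> 'h) set"
  where "bounded_operators = {T. bounded_linear T \<and> (\<forall>c x. T (c *\<^sub>C x) = c *\<^sub>C T x)}"

text \<open>Over the complex numbers a positive quadratic form already forces self-adjointness.\<close>

definition positive_operator :: "('h::chilbert_space \<Rightarrow> 'h) \<Rightarrow> bool"
  where "positive_operator T \<longleftrightarrow> T \<in> bounded_operators \<and> (\<forall>x. cinner (T x) x \<in> \<real>\<^sub>\<ge>\<^sub>0)"

text \<open>
  Elements of the dual of the algebra of bounded operators with the operator norm; values of
  \<open>\<phi>\<close> outside \<^const>\<open>bounded_operators\<close> are irrelevant.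
\<close>

definition operator_functional :: "(('h::chilbert_space \<Rightarrow> 'h) \<Rightarrow> complex) \<Rightarrow> bool"
  where "operator_functional \<phi> \<longleftrightarrow>
    (\<forall>S\<in>bounded_operators. \<forall>T\<in>bounded_operators. \<phi> (\<lambda>x. S x + T x) = \<phi> S + \<phi> T) \<and>
    (\<forall>c. \<forall>T\<in>bounded_operators. \<phi> (\<lambda>x. c *\<^sub>C T x) = c * \<phi> T) \<and>
    (\<exists>K. \<forall>T\<in>bounded_operators. norm (\<phi> T) \<le> K * onorm T)"

definition unitary_group :: "('h::chilbert_space \<Rightarrow> 'h) monoid"
  where "unitary_group =
    \<lparr>carrier = {U \<in> bounded_operators. surj U \<and> (\<forall>x y. cinner (U x) (U y) = cinner x y)},
     monoid.mult = (\<circ>), one = id\<rparr>"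

lemma norm_unitary:
  assumes "U \<in> carrier unitary_group"
  shows "norm (U x) = norm (x :: 'h::chilbert_space)"
proof -
  have "cinner (U x) (U x) = cinner x x"
    using assms by (simp add: unitary_group_def)
  then have "(norm (U x))\<^sup>2 = (norm x)\<^sup>2"
    unfolding cinner_self of_real_eq_iff .
  then show ?thesis by simp
qed

lemma bij_unitary:
  assumes "U \<in> carrier (unitary_group :: ('h::chilbert_space \<Rightarrow> 'h) monoid)"
  shows "bij U"
proof -
  have "bounded_linear U" and "surj U"
    using assms by (simp_all add: unitary_group_def bounded_operators_def)
  moreover have "x = y" if "U x = U y" for x y
  proof -
    have "U (x - y) = 0"
      using that \<open>bounded_linear U\<close> by (simp add: bounded_linear.linear linear_diff)
    then show ?thesis
      using norm_unitary [OF assms, of "x - y"] by simp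
  qed
  ultimately show ?thesis
    by (simp add: bij_def inj_def)
qed

lemma inv_unitary:
  assumes U: "U \<in> carrier (unitary_group :: ('h::chilbert_space \<Rightarrow> 'h) monoid)"
  shows "inv_into UNIV U \<in> carrier unitary_group"
proof -
  let ?V = "inv_into UNIV U"
  have lin: "bounded_linear U" and C: "\<And>c x. U (c *\<^sub>C x) = c *\<^sub>C U x"
    and cin: "\<And>x y. cinner (U x) (U y) = cinner x y"
    using U by (simp_all add: unitary_group_def bounded_operators_def)
  have UV: "U (?V x) = x" for x
    using bij_unitary [OF U] by (simp add: bij_is_surj surj_f_inv_f)
  have VU: "?V (U x) = x" for x
    using bij_unitary [OF U] by (simp add: bij_is_inj inv_f_f)
  have add: "?V (x + y) = ?V x + ?V y" for x y
    using VU [of "?V x + ?V y"] lin UV by (simp add: bounded_linear.linear linear_add)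
  have scale: "?V (c *\<^sub>C x) = c *\<^sub>C ?V x" for c x
    using VU [of "c *\<^sub>C ?V x"] by (simp add: C UV)
  have "bounded_linear ?V"
  proof (rule bounded_linear_intro [where K = 1])
    show "?V (r *\<^sub>R x) = r *\<^sub>R ?V x" for r x
      using scale [of "complex_of_real r" x] by (simp add: scaleC_of_real)
    show "norm (?V x) \<le> norm x * 1" for x
      using norm_unitary [OF U, of "?V x"] by (simp add: UV)
  qed (rule add)
  moreover have "cinner (?V x) (?V y) = cinner x y" for x y
    using cin [of "?V x" "?V y"] by (simp add: UV)
  moreover have "surj ?V"
    using VU by (rule surjI)
  ultimately show ?thesis
    using scale by (simp add: unitary_group_def bounded_operators_def)
qed

lemma group_unitary_group: "group (unitary_group :: ('h::chilbert_space \<Rightarrow> 'h) monoid)"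
proof (rule groupI)
  fix U V :: "'h \<Rightarrow> 'h"
  assume "U \<in> carrier unitary_group" "V \<in> carrier unitary_group"
  then show "U \<otimes>\<^bsub>unitary_group\<^esub> V \<in> carrier unitary_group"
    using comp_surj [of V U]
    by (simp add: unitary_group_def bounded_operators_def bounded_linear_compose o_def)
next
  fix U :: "'h \<Rightarrow> 'h"
  assume U: "U \<in> carrier unitary_group"
  have "inv_into UNIV U \<circ> U = id"
    using bij_unitary [OF U] by (simp add: bij_is_inj)
  then show "\<exists>V\<in>carrier unitary_group. V \<otimes>\<^bsub>unitary_group\<^esub> U = \<one>\<^bsub>unitary_group\<^esub>"
    using inv_unitary [OF U] by (auto simp: unitary_group_def)
qed (auto simp: unitary_group_def bounded_operators_def o_def id_def bounded_linear_ident)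

definition unitary_representation ::
    "('g, 'b) monoid_scheme \<Rightarrow> ('g \<Rightarrow> 'h::chilbert_space \<Rightarrow> 'h) \<Rightarrow> bool"
  where "unitary_representation G \<pi> \<longleftrightarrow> \<pi> \<in> hom G unitary_group"

text \<open>
  In the invariance condition \<^term>\<open>inv_into UNIV (\<pi> g)\<close> is the inverse of the bijection \<open>\<pi> g\<close>
  (the notation \<open>inv\<close> is taken by group inverses).
\<close>

definition amenable_representation ::
    "('g, 'b) monoid_scheme \<Rightarrow> ('g \<Rightarrow> 'h::chilbert_space \<Rightarrow> 'h) \<Rightarrow> bool"
  where "amenable_representation G \<pi> \<longleftrightarrow>
    (\<exists>\<phi> :: ('h \<Rightarrow> 'h) \<Rightarrow> complex.
      operator_functional \<phi> \<and>
      (\<forall>T. positive_operator T \<longrightarrow> \<phi> T \<in> \<real>\<^sub>\<ge>\<^sub>0) \<and>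
      \<phi> id = 1 \<and>
      (\<forall>T\<in>bounded_operators. \<forall>g\<in>carrier G. \<phi> (\<pi> g \<circ> T \<circ> inv_into UNIV (\<pi> g)) = \<phi> T))"

definition sphere_nbhd :: "real \<Rightarrow> 'h::chilbert_space set \<Rightarrow> 'h set"
  where "sphere_nbhd \<epsilon> A = {x \<in> sphere 0 1. \<exists>a\<in>A. dist x a < \<epsilon>}"

definition essential ::
    "('g, 'b) monoid_scheme \<Rightarrow> ('g \<Rightarrow> 'h::chilbert_space \<Rightarrow> 'h) \<Rightarrow> 'h set \<Rightarrow> bool"
  where "essential G \<pi> A \<longleftrightarrow> A \<subseteq> sphere 0 1 \<and>
    (\<forall>\<epsilon>>0. \<forall>F. finite F \<and> F \<subseteq> carrier G \<longrightarrow> (\<Inter>g\<in>F. \<pi> g ` sphere_nbhd \<epsilon> A) \<noteq> {})"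

definition concentration_property ::
    "('g, 'b) monoid_scheme \<Rightarrow> ('g \<Rightarrow> 'h::chilbert_space \<Rightarrow> 'h) \<Rightarrow> bool"
  where "concentration_property G \<pi> \<longleftrightarrow>
    (\<forall>\<C>. finite \<C> \<and> \<Union>\<C> = sphere 0 1 \<longrightarrow> (\<exists>A\<in>\<C>. essential G \<pi> A))"

end

theory Submission
  imports Defs
begin

text \<open>
  The sphere splits into finitely many pieces on which the quadratic forms of finitely many given
  operators \<open>T\<close> oscillate little. Since one piece is essential, some unit vector \<open>x\<close> has its
  translates \<open>\<pi>(g)\<inverse>x\<close>, for finitely many given \<open>g\<close>, all close to that piece, so the vector state
  of \<open>x\<close> nearly takes the same values at \<open>T\<close> and at \<open>\<pi>(g)T\<pi>(g)\<inverse>\<close>. By weak-star compactness of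
  the state space, an exactly invariant state exists.
\<close>

section \<open>Inner product and norm\<close>

lemma cinner_add_right: "cinner x (y + z) = cinner x y + cinner x z"
  for x :: "'h::chilbert_space"
  by (metis cinner_add_left cinner_commute complex_cnj_add)

lemma cinner_diff_left: "cinner (x - y) z = cinner x z - cinner y z"
  for x :: "'h::chilbert_space"
  by (metis cinner_add_left add_diff_cancel_right' diff_add_cancel)

lemma cinner_diff_right: "cinner x (y - z) = cinner x y - cinner x z"
  for x :: "'h::chilbert_space"
  by (metis cinner_add_right add_diff_cancel_right' diff_add_cancel)

text \<open>The Banach space structure only gives homogeneity for real scalars; the complex case
  comes from expanding the inner product that induces the norm.\<close>

lemma norm_scaleC: "norm (c *\<^sub>C x) = cmod c * norm x" for x :: "'h::chilbert_space"
proof -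
  have "cinner (c *\<^sub>C x) (c *\<^sub>C x) = c * cnj c * cinner x x"
    by (metis cinner_commute cinner_scaleC_left complex_cnj_mult mult.assoc)
  then have "complex_of_real ((norm (c *\<^sub>C x))\<^sup>2) = complex_of_real ((cmod c * norm x)\<^sup>2)"
    by (simp add: cinner_self complex_norm_square power_mult_distrib del: of_real_power)
  then have "(norm (c *\<^sub>C x))\<^sup>2 = (cmod c * norm x)\<^sup>2"
    unfolding of_real_eq_iff .
  then show ?thesis by simp
qed

text \<open>The usual deduction is reversed: the triangle inequality is already available for the
  norm, and expanding the square of \<open>norm (x + y)\<close> turns it into the real
  Cauchy-Schwarz inequality.\<close>

lemma Re_cinner_le: "Re (cinner x y) \<le> norm x * norm y" for x :: "'h::chilbert_space"
proof -
  have self: "(norm z)\<^sup>2 = Re (cinner z z)" for z :: 'h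
    unfolding cinner_self by simp
  have "(norm (x + y))\<^sup>2 = Re (cinner (x + y) (x + y))"
    by (rule self)
  also have "\<dots> = (norm x)\<^sup>2 + (norm y)\<^sup>2 + (Re (cinner x y) + Re (cinner y x))"
    by (simp add: cinner_add_left cinner_add_right self)
  also have "Re (cinner y x) = Re (cinner x y)"
    by (subst cinner_commute) simp
  finally have "(norm (x + y))\<^sup>2 = (norm x)\<^sup>2 + (norm y)\<^sup>2 + 2 * Re (cinner x y)"
    by simp
  moreover have "(norm (x + y))\<^sup>2 \<le> (norm x + norm y)\<^sup>2"
    by (simp add: norm_triangle_ineq power_mono)
  ultimately show ?thesis
    by (simp add: power2_sum)
qed

text \<open>Multiplying \<open>x\<close> by a unimodular \<open>c\<close> rotates the inner product
  onto the nonnegative real axis without changing the norm of \<open>x\<close>, which reduces the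
  claim to the bound on real parts.\<close>

lemma norm_cinner_le: "cmod (cinner x y) \<le> norm x * norm y" for x :: "'h::chilbert_space"
proof (cases "cinner x y = 0")
  case False
  define c where "c = cnj (cinner x y) / complex_of_real (cmod (cinner x y))"
  have "cinner (c *\<^sub>C x) y = complex_of_real (cmod (cinner x y))"
    using False unfolding cinner_scaleC_left c_def
    by (simp add: divide_simps mult.commute[of "cnj _"] power2_eq_square flip: complex_norm_square)
  moreover have "cmod c = 1"
    using False by (simp add: c_def norm_divide)
  ultimately show ?thesis
    using Re_cinner_le [of "c *\<^sub>C x" y] by (simp add: norm_scaleC)
qed simp

section \<open>The algebra of bounded operators\<close>

lemma bounded_operators_add:
  assumes "S \<in> bounded_operators" "T \<in> bounded_operators"
  shows "(\<lambda>x. S x + T x) \<in> bounded_operators"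
  using assms by (simp add: bounded_operators_def bounded_linear_add scaleC_add_right)

lemma bounded_operators_scaleC:
  assumes "T \<in> bounded_operators"
  shows "(\<lambda>x. c *\<^sub>C T x) \<in> bounded_operators"
proof -
  have T: "bounded_linear T" and TC: "\<And>d x. T (d *\<^sub>C x) = d *\<^sub>C T x"
    using assms by (auto simp: bounded_operators_def)
  have "bounded_linear (\<lambda>x. c *\<^sub>C x :: 'a)"
  proof (rule bounded_linear_intro [where K = "cmod c"])
    show "c *\<^sub>C (r *\<^sub>R x) = r *\<^sub>R (c *\<^sub>C x)" for r and x :: 'a
      by (metis scaleC_of_real scaleC_scaleC mult.commute)
  qed (simp_all add: scaleC_add_right norm_scaleC mult.commute)
  then show ?thesis
    using bounded_linear_compose [OF _ T] TC
    by (simp add: bounded_operators_def scaleC_scaleC mult.commute)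
qed

lemma bounded_operators_comp:
  assumes "S \<in> bounded_operators" "T \<in> bounded_operators"
  shows "S \<circ> T \<in> bounded_operators"
  using assms by (simp add: bounded_operators_def bounded_linear_compose o_def)

lemma id_bounded_operators: "id \<in> bounded_operators"
  by (simp add: bounded_operators_def id_def bounded_linear_ident)

lemma unitary_bounded_operators:
  "U \<in> carrier unitary_group \<Longrightarrow> U \<in> bounded_operators"
  by (simp add: unitary_group_def)

section \<open>Quadratic forms on the unit sphere\<close>

text \<open>Conjugating the operator amounts to moving the vector: this lets invariance of a vector
  state be read off from the form of \<open>T\<close> alone, at two different points.\<close>

lemma cinner_unitary_conjugate:
  assumes "U \<in> carrier unitary_group"
  shows "cinner ((U \<circ> T \<circ> inv_into UNIV U) (U y)) (U y) = cinner (T y) y"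
  using assms bij_unitary [OF assms] by (simp add: unitary_group_def bij_is_inj)

lemma quadratic_form_bound:
  assumes "T \<in> bounded_operators" "norm x = 1"
  shows "cmod (cinner (T x) x) \<le> onorm T"
proof -
  have "cmod (cinner (T x) x) \<le> norm (T x)"
    using norm_cinner_le [of "T x" x] assms(2) by simp
  also have "\<dots> \<le> onorm T"
    using onorm [of T x] assms by (simp add: bounded_operators_def)
  finally show ?thesis .
qed

text \<open>Adding and subtracting \<open>cinner (T y) x\<close> gives two terms, each containing
  \<open>x - y\<close> once; Cauchy-Schwarz and the operator norm bound each of them.\<close>

lemma quadratic_form_Lipschitz:
  assumes "T \<in> bounded_operators" "norm x = 1" "norm y = 1"
  shows "dist (cinner (T x) x) (cinner (T y) y) \<le> 2 * onorm T * dist x y"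
proof -
  have T: "bounded_linear T"
    using assms by (simp add: bounded_operators_def)
  then have "cinner (T x) x - cinner (T y) y = cinner (T (x - y)) x + cinner (T y) (x - y)"
    by (simp add: bounded_linear.linear linear_diff cinner_diff_left cinner_diff_right)
  then have "dist (cinner (T x) x) (cinner (T y) y)
      \<le> cmod (cinner (T (x - y)) x) + cmod (cinner (T y) (x - y))"
    by (simp add: dist_norm norm_triangle_ineq)
  also have "\<dots> \<le> norm (T (x - y)) * norm x + norm (T y) * norm (x - y)"
    by (intro add_mono norm_cinner_le)
  also have "\<dots> \<le> onorm T * norm (x - y) + onorm T * norm (x - y)"
    using onorm [OF T, of "x - y"] onorm [OF T, of y] assms
    by (intro add_mono mult_right_mono) auto
  finally show ?thesis
    by (simp add: dist_norm)
qed

section \<open>Almost invariant vectors\<close>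

text \<open>Induction on \<open>I\<close>. A bounded set of complex numbers is totally bounded, so
  finitely many balls of radius \<open>\<epsilon> / 2\<close> cover the values of the new function;
  cutting the old pieces along the preimages of these balls yields the finer cover.\<close>

lemma finite_cover_small_oscillation:
  fixes f :: "'i \<Rightarrow> 'a \<Rightarrow> complex"
  assumes "finite I" "\<And>i. i \<in> I \<Longrightarrow> bounded (f i ` S)" "0 < \<epsilon>"
  obtains \<C> where "finite \<C>" "\<Union>\<C> = S"
    "\<And>A i x y. A \<in> \<C> \<Longrightarrow> i \<in> I \<Longrightarrow> x \<in> A \<Longrightarrow> y \<in> A \<Longrightarrow> dist (f i x) (f i y) < \<epsilon>"
proof -
  have "\<exists>\<C>. finite \<C> \<and> \<Union>\<C> = S \<and> (\<forall>A\<in>\<C>. \<forall>i\<in>I. \<forall>x\<in>A. \<forall>y\<in>A. dist (f i x) (f i y) < \<epsilon>)"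
    using assms(1,2)
  proof (induction I rule: finite_induct)
    case empty
    show ?case by (rule exI [of _ "{S}"]) simp
  next
    case (insert j I)
    then obtain \<C> where \<C>: "finite \<C>" "\<Union>\<C> = S"
      "\<forall>A\<in>\<C>. \<forall>i\<in>I. \<forall>x\<in>A. \<forall>y\<in>A. dist (f i x) (f i y) < \<epsilon>"
      by auto
    have "compact (closure (f j ` S))"
      using insert.prems by (simp add: compact_closure)
    then obtain K where K: "finite K" "closure (f j ` S) \<subseteq> (\<Union>z\<in>K. ball z (\<epsilon> / 2))"
      using \<open>0 < \<epsilon>\<close> unfolding compact_eq_totally_bounded by (meson half_gt_zero)
    define \<D> where "\<D> = (\<lambda>(A, z). A \<inter> f j -` ball z (\<epsilon> / 2)) ` (\<C> \<times> K)"
    have "finite \<D>"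
      using \<C>(1) K(1) by (simp add: \<D>_def)
    moreover have "\<Union>\<D> = S"
    proof
      show "\<Union>\<D> \<subseteq> S"
        using \<C>(2) by (auto simp: \<D>_def)
      show "S \<subseteq> \<Union>\<D>"
      proof
        fix x assume "x \<in> S"
        then obtain A where "A \<in> \<C>" "x \<in> A"
          using \<C>(2) by blast
        moreover have "f j x \<in> closure (f j ` S)"
          by (rule subsetD [OF closure_subset imageI [OF \<open>x \<in> S\<close>]])
        then obtain z where "z \<in> K" "f j x \<in> ball z (\<epsilon> / 2)"
          using K(2) by blast
        ultimately show "x \<in> \<Union>\<D>"
          unfolding \<D>_def by blast
      qed
    qed
    moreover have "dist (f i x) (f i y) < \<epsilon>"
      if D: "D \<in> \<D>" and i: "i \<in> insert j I" and x: "x \<in> D" and y: "y \<in> D" for D i x y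
    proof -
      obtain A z where "A \<in> \<C>" "D = A \<inter> f j -` ball z (\<epsilon> / 2)"
        using D by (auto simp: \<D>_def)
      then show ?thesis
        using i x y \<C>(3) dist_triangle_half_r [of z "f j x" \<epsilon> "f j y"] by auto
    qed
    ultimately show ?case by blast
  qed
  then show ?thesis
    using that by blast
qed

text \<open>This is the finite, approximate form of invariance, which the compactness argument later
  turns into exact invariance.\<close>

lemma almost_invariant_vector:
  fixes G :: "('g, 'b) monoid_scheme" and \<pi> :: "'g \<Rightarrow> 'h::chilbert_space \<Rightarrow> 'h"
  assumes "group G" and rep: "unitary_representation G \<pi>"
    and conc: "concentration_property G \<pi>"
    and F: "finite F" "F \<subseteq> carrier G"
    and \<T>: "finite \<T>" "\<T> \<subseteq> bounded_operators"
    and "0 < \<epsilon>"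
  obtains x where "norm x = 1"
    "\<And>g T. g \<in> F \<Longrightarrow> T \<in> \<T> \<Longrightarrow>
      dist (cinner ((\<pi> g \<circ> T \<circ> inv_into UNIV (\<pi> g)) x) x) (cinner (T x) x) < \<epsilon>"
proof -
  let ?q = "\<lambda>T x. cinner (T x) x"
  have U: "\<pi> g \<in> carrier unitary_group" if "g \<in> carrier G" for g
    using rep that by (auto simp: unitary_representation_def hom_def)
  have "\<pi> \<one>\<^bsub>G\<^esub> = \<one>\<^bsub>unitary_group\<^esub>"
    using rep hom_one [OF _ \<open>group G\<close> group_unitary_group]
    by (simp add: unitary_representation_def)
  then have one: "\<pi> \<one>\<^bsub>G\<^esub> = id"
    by (simp add: unitary_group_def)
  have "bounded (?q T ` sphere 0 1)" if "T \<in> \<T>" for T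
    using quadratic_form_bound [of T] that \<T>(2) by (intro boundedI [of _ "onorm T"]) auto
  then obtain \<C> where \<C>: "finite \<C>" "\<Union>\<C> = sphere (0::'h) 1"
    "\<And>A T x y. A \<in> \<C> \<Longrightarrow> T \<in> \<T> \<Longrightarrow> x \<in> A \<Longrightarrow> y \<in> A \<Longrightarrow> dist (?q T x) (?q T y) < \<epsilon> / 2"
    using finite_cover_small_oscillation [OF \<T>(1), of ?q "sphere 0 1" "\<epsilon> / 2"] \<open>0 < \<epsilon>\<close>
    by (auto simp: image_def)
  then obtain A where A: "A \<in> \<C>" "essential G \<pi> A"
    using conc unfolding concentration_property_def by blast
  \<comment> \<open>A common bound for the operator norms; as a sum it is also meaningful for empty
    \<open>\<T>\<close>.\<close>
  define M where "M = (\<Sum>T\<in>\<T>. onorm T)"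
  have nonneg: "0 \<le> onorm T" if "T \<in> \<T>" for T
    using \<T>(2) that onorm_pos_le [of T] by (auto simp: bounded_operators_def)
  then have M: "onorm T \<le> M" if "T \<in> \<T>" for T
    unfolding M_def using \<T>(1) that by (intro member_le_sum) auto
  have "0 \<le> M"
    unfolding M_def using nonneg by (simp add: sum_nonneg)
  \<comment> \<open>Chosen so that moving a unit vector by less than \<delta> changes each form by
    at most a quarter of \<epsilon>; adding 1 keeps the denominator positive when \<open>M\<close>
    is 0.\<close>
  define \<delta> where "\<delta> = \<epsilon> / (8 * (M + 1))"
  have \<delta>: "0 < \<delta>" "2 * M * \<delta> \<le> \<epsilon> / 4"
    using \<open>0 \<le> M\<close> \<open>0 < \<epsilon>\<close> by (auto simp: \<delta>_def field_simps)
  \<comment> \<open>The unit of \<open>G\<close> is added because \<pi> sends it to the identity: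
    then \<open>x\<close> itself, and not only its translates, lies near \<open>A\<close>.\<close>
  have "finite (insert \<one>\<^bsub>G\<^esub> F)" "insert \<one>\<^bsub>G\<^esub> F \<subseteq> carrier G"
    using F \<open>group G\<close> by (auto simp: group.is_monoid monoid.one_closed)
  then have "(\<Inter>g\<in>insert \<one>\<^bsub>G\<^esub> F. \<pi> g ` sphere_nbhd \<delta> A) \<noteq> {}"
    using A(2) \<delta>(1) by (simp only: essential_def simp_thms)
  then obtain x where x: "\<And>g. g \<in> insert \<one>\<^bsub>G\<^esub> F \<Longrightarrow> x \<in> \<pi> g ` sphere_nbhd \<delta> A"
    by fast
  have near: "\<exists>a\<in>A. \<forall>T\<in>\<T>. dist (?q T y) (?q T a) \<le> \<epsilon> / 4" if y: "y \<in> sphere_nbhd \<delta> A" for y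
  proof -
    obtain a where a: "a \<in> A" "dist y a < \<delta>" "norm y = 1"
      using y by (auto simp: sphere_nbhd_def)
    then have "norm a = 1"
      using A \<C>(2) by auto
    have "dist (?q T y) (?q T a) \<le> \<epsilon> / 4" if "T \<in> \<T>" for T
    proof -
      have "dist (?q T y) (?q T a) \<le> 2 * onorm T * dist y a"
        using quadratic_form_Lipschitz a \<open>norm a = 1\<close> \<T>(2) that by blast
      also have "\<dots> \<le> 2 * M * \<delta>"
        using a M [OF that] nonneg [OF that] \<open>0 \<le> M\<close> by (intro mult_mono) auto
      finally show ?thesis
        using \<delta>(2) by simp
    qed
    then show ?thesis
      using a(1) by blast
  qed
  have x': "x \<in> sphere_nbhd \<delta> A"
    using x [of "\<one>\<^bsub>G\<^esub>"] one by simp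
  show ?thesis
  proof
    show "norm x = 1"
      using x' by (simp add: sphere_nbhd_def)
    fix g T assume gT: "g \<in> F" "T \<in> \<T>"
    then obtain y where y: "y \<in> sphere_nbhd \<delta> A" "x = \<pi> g y"
      using x by blast
    obtain a b where "a \<in> A" "dist (?q T y) (?q T a) \<le> \<epsilon> / 4"
      and "b \<in> A" "dist (?q T x) (?q T b) \<le> \<epsilon> / 4"
      using near [OF y(1)] near [OF x'] gT(2) by blast
    moreover from this have "dist (?q T a) (?q T b) < \<epsilon> / 2"
      using \<C>(3) A(1) gT(2) by blast
    \<comment> \<open>Passing from \<open>y\<close> to \<open>a\<close> and from \<open>b\<close> to
      \<open>x\<close> costs a quarter of \<epsilon> each; the small oscillation on \<open>A\<close>
      leaves strictly less than half of \<epsilon> between \<open>a\<close> and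
      \<open>b\<close>.\<close>
    moreover have "dist (?q T y) (?q T x)
        \<le> dist (?q T y) (?q T a) + dist (?q T a) (?q T b) + dist (?q T x) (?q T b)"
      by metric
    ultimately have "dist (?q T y) (?q T x) < \<epsilon>"
      by simp
    then show "dist (?q (\<pi> g \<circ> T \<circ> inv_into UNIV (\<pi> g)) x) (?q T x) < \<epsilon>"
      using cinner_unitary_conjugate [OF U, of g T y] gT(1) F(2) y(2) by auto
  qed
qed

section \<open>The state space and its compactness\<close>

text \<open>Values outside the bounded operators are set to 0, which makes the state space compact.\<close>

definition states :: "(('h::chilbert_space \<Rightarrow> 'h) \<Rightarrow> complex) set"
  where "states = {\<phi>. (\<forall>T. norm (\<phi> T) \<le> (if T \<in> bounded_operators then onorm T else 0)) \<and>
    (\<forall>S\<in>bounded_operators. \<forall>T\<in>bounded_operators. \<phi> (\<lambda>x. S x + T x) = \<phi> S + \<phi> T) \<and>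
    (\<forall>c. \<forall>T\<in>bounded_operators. \<phi> (\<lambda>x. c *\<^sub>C T x) = c * \<phi> T) \<and>
    (\<forall>T. positive_operator T \<longrightarrow> \<phi> T \<in> \<real>\<^sub>\<ge>\<^sub>0) \<and> \<phi> id = 1}"

text \<open>The value 0 off the bounded operators is forced by the norm condition in
  \<open>states\<close>.\<close>

definition vector_state :: "'h::chilbert_space \<Rightarrow> ('h \<Rightarrow> 'h) \<Rightarrow> complex"
  where "vector_state x T = (if T \<in> bounded_operators then cinner (T x) x else 0)"

lemma vector_state_in_states:
  assumes "norm x = 1"
  shows "vector_state x \<in> states"
  using assms quadratic_form_bound [of _ x]
  by (auto simp: states_def vector_state_def bounded_operators_add bounded_operators_scaleC
      id_bounded_operators cinner_add_left cinner_scaleC_left cinner_self positive_operator_def)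

text \<open>The Banach-Alaoglu argument: by Tychonoff the product \<open>?K\<close> of closed discs
  is compact for pointwise convergence, and every remaining condition is an intersection of closed
  conditions on finitely many coordinates each.\<close>

lemma compact_states: "compact (states :: (('h::chilbert_space \<Rightarrow> 'h) \<Rightarrow> complex) set)"
proof -
  let ?B = "bounded_operators :: ('h \<Rightarrow> 'h) set"
  let ?K = "PiE UNIV (\<lambda>T. cball (0::complex) (if T \<in> ?B then onorm T else 0))"
  let ?add = "{\<phi> :: ('h \<Rightarrow> 'h) \<Rightarrow> complex. \<forall>S\<in>?B. \<forall>T\<in>?B. \<phi> (\<lambda>x. S x + T x) = \<phi> S + \<phi> T}"
  let ?scale = "{\<phi> :: ('h \<Rightarrow> 'h) \<Rightarrow> complex. \<forall>c. \<forall>T\<in>?B. \<phi> (\<lambda>x. c *\<^sub>C T x) = c * \<phi> T}"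
  let ?pos = "{\<phi> :: ('h \<Rightarrow> 'h) \<Rightarrow> complex. \<forall>T. positive_operator T \<longrightarrow> \<phi> T \<in> \<real>\<^sub>\<ge>\<^sub>0}"
  let ?unit = "{\<phi> :: ('h \<Rightarrow> 'h) \<Rightarrow> complex. \<phi> id = 1}"
  note ev = continuous_on_product_coordinates
  have "compactin (product_topology (\<lambda>T. euclidean) UNIV) ?K"
    by (simp add: compactin_PiE)
  then have "compact ?K"
    unfolding euclidean_product_topology compactin_euclidean_iff .
  moreover have "closed ?add"
    unfolding Ball_def
    by (intro closed_Collect_all closed_Collect_imp closed_Collect_eq open_Collect_const
        continuous_intros ev)
  moreover have "closed ?scale"
    unfolding Ball_def
    by (intro closed_Collect_all closed_Collect_imp closed_Collect_eq open_Collect_const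
        continuous_intros ev)
  moreover have "closed ?pos"
    using closed_vimage [OF closed_nonneg_Reals_complex ev]
    by (intro closed_Collect_all closed_Collect_imp open_Collect_const) (simp add: vimage_def)
  moreover have "closed ?unit"
    by (intro closed_Collect_eq continuous_intros ev)
  ultimately have "compact (?K \<inter> (?add \<inter> ?scale \<inter> ?pos \<inter> ?unit))"
    by (intro compact_Int_closed closed_Int)
  also have "?K \<inter> (?add \<inter> ?scale \<inter> ?pos \<inter> ?unit) = states"
    by (simp add: set_eq_iff states_def PiE_iff conj_ac)
  finally show ?thesis .
qed

section \<open>From approximate to exact invariance\<close>

theorem corollary3p3:
  fixes G :: "('g, 'b) monoid_scheme"
    and \<pi> :: "'g \<Rightarrow> 'h::chilbert_space \<Rightarrow> 'h"
  assumes "group G"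
    and "unitary_representation G \<pi>"
    and "concentration_property G \<pi>"
  shows "amenable_representation G \<pi>"
proof -
  let ?conj = "\<lambda>g T. \<pi> g \<circ> T \<circ> inv_into UNIV (\<pi> g)"
  let ?I = "carrier G \<times> bounded_operators \<times> {0::real<..}"
  \<comment> \<open>Vector states are only known to be approximately invariant, hence the tolerance
    in the index; the non-strict inequality makes each set closed.\<close>
  define C where "C = (\<lambda>(g, T, \<epsilon>). {\<phi> :: ('h \<Rightarrow> 'h) \<Rightarrow> complex. dist (\<phi> (?conj g T)) (\<phi> T) \<le> \<epsilon>})"
  have conj: "?conj g T \<in> bounded_operators" if "g \<in> carrier G" "T \<in> bounded_operators" for g T
  proof -
    have "\<pi> g \<in> carrier unitary_group"
      using assms(2) that(1) by (auto simp: unitary_representation_def hom_def)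
    then show ?thesis
      by (intro bounded_operators_comp that(2)) (auto intro: unitary_bounded_operators inv_unitary)
  qed
  have "states \<inter> \<Inter>(C ` ?I) \<noteq> {}"
  \<comment> \<open>By compactness it suffices to find, for finitely many of these sets, one state
    in all of them; a vector state will do.\<close>
  proof (rule compact_imp_fip [OF compact_states])
    show "closed A" if "A \<in> C ` ?I" for A
      using that unfolding C_def
      by (auto intro!: closed_Collect_le continuous_intros continuous_on_product_coordinates)
    fix \<A> assume "finite \<A>" "\<A> \<subseteq> C ` ?I"
    then obtain J where J: "finite J" "J \<subseteq> ?I" "\<A> = C ` J"
      by (meson finite_subset_image)
    \<comment> \<open>The smallest tolerance occurring in \<open>J\<close> serves for all its
      members; the extra 1 covers the case of empty \<open>J\<close>.\<close>
    define \<epsilon> where "\<epsilon> = Min (insert 1 ((snd \<circ> snd) ` J))"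
    have "0 < \<epsilon>"
      unfolding \<epsilon>_def using J(1,2) by (subst Min_gr_iff) auto
    have \<epsilon>_le: "\<epsilon> \<le> snd (snd j)" if "j \<in> J" for j
      unfolding \<epsilon>_def using J(1) that by (intro Min_le) auto
    have "finite (fst ` J)" "fst ` J \<subseteq> carrier G"
      "finite ((fst \<circ> snd) ` J)" "(fst \<circ> snd) ` J \<subseteq> bounded_operators"
      using J(1,2) by auto
    from almost_invariant_vector [OF assms this \<open>0 < \<epsilon>\<close>]
    obtain x where x: "norm x = 1"
      "\<And>g T. g \<in> fst ` J \<Longrightarrow> T \<in> (fst \<circ> snd) ` J \<Longrightarrow>
        dist (cinner (?conj g T x) x) (cinner (T x) x) < \<epsilon>"
      by blast
    have "vector_state x \<in> C j" if j: "j \<in> J" for j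
    proof -
      obtain g T e where [simp]: "j = (g, T, e)"
        by (cases j)
      have gT: "g \<in> carrier G" "T \<in> bounded_operators"
        using j J(2) by auto
      have "dist (cinner (?conj g T x) x) (cinner (T x) x) < \<epsilon>"
        using j by (intro x(2)) force+
      then show ?thesis
        using gT conj [OF gT] \<epsilon>_le [OF j] by (simp add: C_def vector_state_def)
    qed
    then show "states \<inter> \<Inter>\<A> \<noteq> {}"
      using vector_state_in_states [OF x(1)] J(3) by blast
  qed
  then obtain \<phi> where \<phi>: "\<phi> \<in> states" "\<And>g T \<epsilon>. g \<in> carrier G \<Longrightarrow> T \<in> bounded_operators \<Longrightarrow>
      0 < \<epsilon> \<Longrightarrow> dist (\<phi> (?conj g T)) (\<phi> T) \<le> \<epsilon>"
    by (fastforce simp: C_def)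
  \<comment> \<open>The distance is below every positive tolerance, hence 0.\<close>
  have "\<phi> (?conj g T) = \<phi> T" if "g \<in> carrier G" "T \<in> bounded_operators" for g T
    using \<phi>(2) [OF that] field_le_epsilon [of "dist (\<phi> (?conj g T)) (\<phi> T)" 0] by simp
  moreover have "\<forall>T\<in>bounded_operators. norm (\<phi> T) \<le> 1 * onorm T"
  proof
    fix T :: "'h \<Rightarrow> 'h" assume "T \<in> bounded_operators"
    moreover have "norm (\<phi> T) \<le> (if T \<in> bounded_operators then onorm T else 0)"
      using \<phi>(1) by (simp add: states_def)
    ultimately show "norm (\<phi> T) \<le> 1 * onorm T"
      by simp
  qed
  then have "operator_functional \<phi>"
    using \<phi>(1) unfolding operator_functional_def states_def by blast
  ultimately show ?thesis
    using \<phi>(1) unfolding amenable_representation_def states_def by blast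
qed

end
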